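(* Let $n\ge 1$ and $X=\mathbb{R}^n$. Every non-trivial topologically invariant $\sigma$-ideal $\mathcal{I}$ on $X$ with BP-base is contained in the ideal $\mathcal{M}$ of meager subsets of $X$.
   Context: An ideal on a set $X$ is a non-empty family of subsets of $X$ closed under taking subsets and finite unions; a $\sigma$-ideal is moreover closed under countable unions. An ideal $\mathcal I$ on $X$ is non-trivial if it contains an uncountable set and $\mathcal I\neq\mathcal P(X)$. A $\sigma$-ideal $\mathcal I$ on a topological space $X$ is topologically invariant if $\mathcal I=\{h(A):A\in\mathcal I\}$ for every homeomorphism $h:X\to X$. A base of $\mathcal I$ is a subfamily $\mathcal B\subseteq\mathcal I$ such that every $A\in\mathcal I$ is contained in some $B\in\mathcal B$. $\mathcal I$ has BP-base if it has a base consisting of sets with the Baire property in $X$ (a set $A$ has the Baire property if $A\triangle U$ is meager for some open $U$). *)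

theory Defs
  imports "HOL-Analysis.Analysis"
begin

text \<open>The underlying space \<open>X\<close> of all notions below is the whole type \<open>'a\<close>.
  An ideal need not be proper; properness is part of \<open>nontrivial_ideal\<close>.\<close>

definition set_ideal :: "'a set set \<Rightarrow> bool" where
  "set_ideal \<I> \<longleftrightarrow> \<I> \<noteq> {} \<and>
     (\<forall>A\<in>\<I>. \<forall>B. B \<subseteq> A \<longrightarrow> B \<in> \<I>) \<and>
     (\<forall>A\<in>\<I>. \<forall>B\<in>\<I>. A \<union> B \<in> \<I>)"

definition set_sigma_ideal :: "'a set set \<Rightarrow> bool" where
  "set_sigma_ideal \<I> \<longleftrightarrow> set_ideal \<I> \<and>
     (\<forall>\<C>. countable \<C> \<longrightarrow> \<C> \<subseteq> \<I> \<longrightarrow> \<Union>\<C> \<in> \<I>)"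

definition nontrivial_ideal :: "'a set set \<Rightarrow> bool" where
  "nontrivial_ideal \<I> \<longleftrightarrow> (\<exists>A\<in>\<I>. uncountable A) \<and> \<I> \<noteq> Pow UNIV"

definition topologically_invariant :: "'a::topological_space set set \<Rightarrow> bool" where
  "topologically_invariant \<I> \<longleftrightarrow>
     (\<forall>h g. homeomorphism (UNIV :: 'a set) (UNIV :: 'a set) h g \<longrightarrow> \<I> = {h ` A | A. A \<in> \<I>})"

definition ideal_base :: "'a set set \<Rightarrow> 'a set set \<Rightarrow> bool" where
  "ideal_base \<I> \<B> \<longleftrightarrow> \<B> \<subseteq> \<I> \<and> (\<forall>A\<in>\<I>. \<exists>B\<in>\<B>. A \<subseteq> B)"

definition nowhere_dense :: "'a::topological_space set \<Rightarrow> bool" where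
  "nowhere_dense A \<longleftrightarrow> interior (closure A) = {}"

definition meager :: "'a::topological_space set \<Rightarrow> bool" where
  "meager A \<longleftrightarrow> (\<exists>\<C>. countable \<C> \<and> (\<forall>C\<in>\<C>. nowhere_dense C) \<and> A = \<Union>\<C>)"

definition has_Baire_property :: "'a::topological_space set \<Rightarrow> bool" where
  "has_Baire_property A \<longleftrightarrow> (\<exists>U. open U \<and> meager (sym_diff A U))"

definition has_BP_base :: "'a::topological_space set set \<Rightarrow> bool" where
  "has_BP_base \<I> \<longleftrightarrow> (\<exists>\<B>. ideal_base \<I> \<B> \<and> (\<forall>B\<in>\<B>. has_Baire_property B))"

end

theory Submission
  imports Defs
begin

text \<open>If \<open>\<I>\<close> contains a nonmeager set, then the Baire property and countably many translations give
  a comeager \<open>A \<in> \<I>\<close>. We enlarge \<open>A\<close> to the whole space one coordinate at a time. Let \<open>h\<close> act as an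
  increasing homeomorphism \<open>g\<close> of the line on coordinate \<open>i\<close> and trivially on the others. A line
  parallel to axis \<open>i\<close> lies in \<open>A \<union> h A\<close> as soon as its trace \<open>F\<close> on the complement of \<open>A\<close> satisfies
  \<open>F \<inter> g F = {}\<close>. A Baire category argument in the space of monotone maps at bounded distance from
  the identity yields one \<open>g\<close> for which this holds for comeagerly many lines. These lines form a
  comeager member of \<open>\<I>\<close> that is a cylinder in direction \<open>i\<close>, and being a cylinder in the directions
  treated earlier is preserved.\<close>

section \<open>Meager sets and the Baire category theorem\<close>

lemma nowhere_dense_subset: "nowhere_dense A \<Longrightarrow> B \<subseteq> A \<Longrightarrow> nowhere_dense B"
  unfolding nowhere_dense_def by (metis closure_mono interior_mono subset_empty)

lemma meager_subset:
  assumes "meager A" "B \<subseteq> A"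
  shows "meager B"
proof -
  obtain \<C> where \<C>: "countable \<C>" "\<forall>C\<in>\<C>. nowhere_dense C" "A = \<Union>\<C>"
    using assms(1) unfolding meager_def by blast
  show ?thesis
    unfolding meager_def
  proof (intro exI[of _ "(\<lambda>C. C \<inter> B) ` \<C>"] conjI)
    show "\<forall>C\<in>(\<lambda>C. C \<inter> B) ` \<C>. nowhere_dense C"
      using \<C>(2) by (auto intro: nowhere_dense_subset)
  qed (use \<C> assms(2) in auto)
qed

lemma meager_Union:
  assumes "countable \<A>" "\<And>A. A \<in> \<A> \<Longrightarrow> meager A"
  shows "meager (\<Union>\<A>)"
proof -
  have "\<forall>A\<in>\<A>. \<exists>\<C>. countable \<C> \<and> (\<forall>C\<in>\<C>. nowhere_dense C) \<and> A = \<Union>\<C>"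
    using assms(2) unfolding meager_def by blast
  then obtain \<C> where \<C>: "\<And>A. A \<in> \<A> \<Longrightarrow> countable (\<C> A) \<and> (\<forall>C\<in>\<C> A. nowhere_dense C) \<and> A = \<Union>(\<C> A)"
    by metis
  show ?thesis
    unfolding meager_def
  proof (intro exI[of _ "\<Union>(\<C> ` \<A>)"] conjI)
    show "countable (\<Union>(\<C> ` \<A>))" using assms(1) \<C> by blast
    show "\<forall>C\<in>\<Union>(\<C> ` \<A>). nowhere_dense C" using \<C> by blast
    show "\<Union>\<A> = \<Union>(\<Union>(\<C> ` \<A>))" using \<C> by fastforce
  qed
qed

lemma meager_translation:
  fixes A :: "'a::real_normed_vector set"
  assumes "meager A"
  shows "meager ((+) q ` A)"
proof -
  obtain \<C> where \<C>: "countable \<C>" "\<forall>C\<in>\<C>. nowhere_dense C" "A = \<Union>\<C>"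
    using assms(1) unfolding meager_def by blast
  have "nowhere_dense ((+) q ` C)" if "nowhere_dense C" for C
    using that by (simp add: nowhere_dense_def closure_translation interior_translation)
  then show ?thesis
    unfolding meager_def using \<C>
    by (intro exI[of _ "(`) ((+) q) ` \<C>"]) auto
qed

text \<open>Finite unions of closures of the nowhere dense pieces form the cover. It is increasing
  so that two points of \<open>A\<close> always lie in a common \<open>F k\<close>, as is needed
  when a point of a line and its image under \<open>g\<close> are compared.\<close>

lemma meager_increasing_closed_cover:
  assumes "meager A"
  obtains F :: "nat \<Rightarrow> 'a::topological_space set"
  where "\<forall>k. closed (F k) \<and> interior (F k) = {}" "mono F" "A \<subseteq> (\<Union>k. F k)"
proof -
  obtain \<C> where \<C>: "countable \<C>" "\<forall>C\<in>\<C>. nowhere_dense C" "A = \<Union>\<C>"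
    using assms(1) unfolding meager_def by blast
  \<comment> \<open>The empty set is added because an empty family is not the range of a
    sequence.\<close>
  have "countable (insert {} \<C>)" "insert {} \<C> \<noteq> {}" using \<C> by auto
  then obtain c :: "nat \<Rightarrow> 'a set" where c: "insert {} \<C> = range c"
    using range_from_nat_into by metis
  have nd: "nowhere_dense (c j)" for j
  proof -
    have "c j \<in> insert {} \<C>" using c by simp
    then show ?thesis using \<C>(2) by (auto simp: nowhere_dense_def)
  qed
  define F where "F k = (\<Union>j\<le>k. closure (c j))" for k
  have cl: "closed (F k)" for k unfolding F_def by auto
  have "interior (F k) = {}" for k
  proof (induction k)
    case 0
    then show ?case using nd[of 0] by (simp add: F_def nowhere_dense_def)
  next
    case (Suc k)
    have "F (Suc k) = F k \<union> closure (c (Suc k))"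
      by (auto simp: F_def atMost_Suc)
    then show ?case
      using interior_closed_Un_empty_interior[OF cl[of k], of "closure (c (Suc k))"] nd[of "Suc k"] Suc
      by (simp add: nowhere_dense_def)
  qed
  moreover have "mono F" unfolding mono_def F_def by (intro allI impI UN_mono) auto
  moreover have "A \<subseteq> (\<Union>k. F k)"
  proof
    fix x assume "x \<in> A"
    then obtain C where "C \<in> \<C>" "x \<in> C" using \<C>(3) by blast
    then obtain j where "x \<in> c j" using c by (metis insertCI rangeE)
    then have "x \<in> F j" unfolding F_def using closure_subset by blast
    then show "x \<in> (\<Union>k. F k)" by blast
  qed
  ultimately show ?thesis using that[of F] cl by blast
qed

lemma meager_Compl_Inter_open_dense:
  assumes "\<And>k::nat. open (U k)" "\<And>k. closure (U k) = UNIV"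
  shows "meager (- (\<Inter>k. U k))"
  unfolding meager_def
proof (intro exI[of _ "range (\<lambda>k. - U k)"] conjI)
  show "\<forall>C\<in>range (\<lambda>k. - U k). nowhere_dense C"
    using assms by (auto simp: nowhere_dense_def closure_closed closed_Compl interior_complement)
qed auto

lemma not_meager_UNIV: "\<not> meager (UNIV :: 'a::{real_normed_vector,heine_borel} set)"
proof
  assume "meager (UNIV :: 'a set)"
  then obtain F :: "nat \<Rightarrow> 'a set" where F: "\<forall>k. closed (F k) \<and> interior (F k) = {}" "mono F" "UNIV \<subseteq> (\<Union>k. F k)"
    by (rule meager_increasing_closed_cover)
  have "(UNIV :: 'a set) \<subseteq> closure (\<Inter>(range (\<lambda>k. - F k)))"
  proof (rule Baire)
    fix T assume "T \<in> range (\<lambda>k. - F k)"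
    then obtain k where "T = - F k" by blast
    then show "openin (top_of_set UNIV) T \<and> UNIV \<subseteq> closure T"
      using F(1) by (simp add: closure_complement open_Compl)
  qed auto
  moreover have "\<Inter>(range (\<lambda>k. - F k)) = {}" using F(3) by blast
  ultimately show False by simp
qed

section \<open>Lines parallel to a coordinate axis, and gaps of closed sets along them\<close>

text \<open>As \<open>t\<close> varies, this runs through the line through \<open>x\<close> parallel
  to axis \<open>i\<close>. The old value \<open>x $ i\<close> is forgotten, so all points of one
  line give the same parametrisation.\<close>

definition upd :: "'n \<Rightarrow> real ^ 'n \<Rightarrow> real \<Rightarrow> real ^ 'n::finite" where
  "upd i x t = (\<chi> j. if j = i then t else x $ j)"

lemma upd_nth [simp]: "upd i x t $ j = (if j = i then t else x $ j)"
  by (simp add: upd_def)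

lemma upd_same [simp]: "upd i x (x $ i) = x"
  by (simp add: vec_eq_iff)

lemma upd_upd [simp]: "upd i (upd i x s) t = upd i x t"
  by (simp add: vec_eq_iff)

lemma upd_commute: "i \<noteq> j \<Longrightarrow> upd i (upd j x s) t = upd j (upd i x t) s"
  by (auto simp: vec_eq_iff)

lemma continuous_on_upd [continuous_intros]:
  assumes "continuous_on S f" "continuous_on S g"
  shows "continuous_on S (\<lambda>z. upd i (f z) (g z))"
proof -
  have "continuous_on S (\<lambda>z. \<chi> j. if j = i then g z else f z $ j)"
  proof (rule continuous_on_vec_lambda)
    show "continuous_on S (\<lambda>z. if j = i then g z else f z $ j)" for j
      using assms by (cases "j = i") (auto intro: continuous_intros)
  qed
  then show ?thesis by (simp add: upd_def)
qed

text \<open>The elements of \<open>S\<close> are treated one after another. Each time the emptiness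
  of the interior of \<open>F\<close> gives a point off \<open>F\<close>, closedness spreads it to a
  box, and \<open>B\<close> and the interval of shifts shrink to that box; one interval finally
  serves all of \<open>S\<close>.\<close>

lemma avoid_translates:
  fixes F :: "(real ^ 'n::finite) set"
  assumes "finite S" and F: "closed F" "interior F = {}"
    and "open B" "B \<noteq> {}" "open V" "V \<noteq> {}"
  shows "\<exists>B' a b. open B' \<and> B' \<noteq> {} \<and> B' \<subseteq> B \<and> a < b \<and> {a..b} \<subseteq> V \<and>
           (\<forall>x\<in>B'. \<forall>\<tau>\<in>{a..b}. \<forall>s\<in>S. upd i x (s + \<tau>) \<notin> F)"
  using \<open>finite S\<close>
proof (induction S rule: finite_induct)
  case empty
  obtain v where "v \<in> V" using assms by blast
  then obtain e where "e > 0" "cball v e \<subseteq> V" using \<open>open V\<close> open_contains_cball by blast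
  then have "{v..v+e} \<subseteq> V" by (auto simp: subset_iff dist_real_def)
  then show ?case using \<open>e > 0\<close> assms by (intro exI[of _ B] exI[of _ v] exI[of _ "v+e"]) auto
next
  case (insert s S)
  then obtain B1 a b where B1: "open B1" "B1 \<noteq> {}" "B1 \<subseteq> B" "a < b" "{a..b} \<subseteq> V"
    and S: "\<forall>x\<in>B1. \<forall>\<tau>\<in>{a..b}. \<forall>s\<in>S. upd i x (s + \<tau>) \<notin> F"
    by blast
  obtain x1 where x1: "x1 \<in> B1" using B1 by blast
  \<comment> \<open>\<open>W\<close> consists of the points \<open>upd i x (s + \<tau>)\<close> with
    \<open>x\<close> in \<open>B1\<close>, \<open>x $ i = x1 $ i\<close> and
    \<open>a < \<tau> < b\<close>. It is open in the whole space, hence not contained in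
    \<open>F\<close>.\<close>
  define W where "W = {z. a < z $ i - s \<and> z $ i - s < b} \<inter> (\<lambda>z. upd i z (x1 $ i)) -` B1"
  have "open W" unfolding W_def
    by (intro open_Int open_vimage \<open>open B1\<close> open_Collect_conj open_Collect_less continuous_intros)
  moreover have "upd i x1 (s + (a + b)/2) \<in> W"
    using x1 \<open>a < b\<close> by (simp add: W_def field_simps)
  ultimately have "\<not> W \<subseteq> F" using F(2) interior_maximal by blast
  then obtain z where z: "z \<in> W" "z \<notin> F" by blast
  \<comment> \<open>Openness of \<open>O'\<close> spreads the good pair obtained from
    \<open>z\<close> to a box of base points and shifts.\<close>
  define O' where "O' = {p. upd i (fst p) (s + snd p) \<notin> F} \<inter> B1 \<times> {a<..<b}"
  have "open {p. upd i (fst p) (s + snd p) \<notin> F}"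
  proof -
    have "open ((\<lambda>p. upd i (fst p) (s + snd p)) -` (- F))"
      using F(1) by (intro open_vimage continuous_intros) auto
    then show ?thesis by (simp add: vimage_def)
  qed
  then have "open O'" unfolding O'_def using B1 by (intro open_Int open_Times) auto
  moreover have "(upd i z (x1 $ i), z $ i - s) \<in> O'"
    using z by (auto simp: O'_def W_def)
  ultimately obtain B2 V2 where *: "open B2" "open V2" "(upd i z (x1 $ i), z $ i - s) \<in> B2 \<times> V2" "B2 \<times> V2 \<subseteq> O'"
    by (rule open_prod_elim)
  then have "z $ i - s \<in> V2" by simp
  then obtain e where e: "e > 0" "cball (z $ i - s) e \<subseteq> V2" using \<open>open V2\<close> open_contains_cball by blast
  define v where "v = z $ i - s"
  have "{v..v+e} \<subseteq> V2" using e by (auto simp: subset_iff dist_real_def v_def)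
  then have sub: "x \<in> B2 \<Longrightarrow> \<tau> \<in> {v..v+e} \<Longrightarrow> (x, \<tau>) \<in> O'" for x \<tau>
    using *(4) by blast
  have ne: "B2 \<noteq> {}" using * by blast
  have "B2 \<subseteq> B1" using sub[of _ v] e by (force simp: O'_def)
  moreover have "{v..v+e} \<subseteq> {a..b}" using sub ne by (fastforce simp: O'_def)
  moreover have "upd i x (s + \<tau>) \<notin> F" if "x \<in> B2" "\<tau> \<in> {v..v+e}" for x \<tau>
    using sub[OF that] by (simp add: O'_def)
  moreover have "upd i x (r + \<tau>) \<notin> F" if "x \<in> B2" "\<tau> \<in> {v..v+e}" "r \<in> S" for x \<tau> r
    using S that \<open>B2 \<subseteq> B1\<close> \<open>{v..v+e} \<subseteq> {a..b}\<close> by blast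
  ultimately have "\<forall>x\<in>B2. \<forall>\<tau>\<in>{v..v+e}. \<forall>r\<in>insert s S. upd i x (r + \<tau>) \<notin> F"
    unfolding ball_simps by simp
  moreover have "v < v + e" using e by simp
  moreover have "B2 \<subseteq> B" using \<open>B2 \<subseteq> B1\<close> B1(3) by (rule order_trans)
  moreover have "{v..v+e} \<subseteq> V" using \<open>{v..v+e} \<subseteq> {a..b}\<close> B1(5) by (rule order_trans)
  ultimately show ?case
    using *(1) ne by (intro exI[of _ B2] exI[of _ v] exI[of _ "v+e"] conjI)
qed

section \<open>Collapsing maps of the line\<close>

text \<open>For \<open>0 < a < b < \<eta>\<close> this is piecewise linear: on the cell
  \<open>{p..p + \<eta>}\<close> it stays at \<open>p\<close> up to \<open>p + a\<close>, climbs to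
  \<open>p + \<eta>\<close> between \<open>p + a\<close> and \<open>p + b\<close>, and stays there.
  Outside the cell the two correction terms cancel and leave the identity.\<close>

definition cell_collapse :: "real \<Rightarrow> real \<Rightarrow> real \<Rightarrow> real \<Rightarrow> real \<Rightarrow> real" where
  "cell_collapse \<eta> a b p y = y - max 0 (min \<eta> (y - p)) + \<eta> * max 0 (min 1 ((y - p - a) / (b - a)))"

lemma cell_collapse:
  assumes "0 < a" "a < b" "b < \<eta>"
  shows "mono (cell_collapse \<eta> a b p)" "continuous_on UNIV (cell_collapse \<eta> a b p)"
    and "y \<le> p \<or> p + \<eta> \<le> y \<Longrightarrow> cell_collapse \<eta> a b p y = y"
    and "p \<le> y \<Longrightarrow> y \<le> p + \<eta> \<Longrightarrow> p \<le> cell_collapse \<eta> a b p y \<and> cell_collapse \<eta> a b p y \<le> p + \<eta>"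
    and "p \<le> y \<Longrightarrow> y \<le> p + a \<Longrightarrow> cell_collapse \<eta> a b p y = p"
    and "p + b \<le> y \<Longrightarrow> y \<le> p + \<eta> \<Longrightarrow> cell_collapse \<eta> a b p y = p + \<eta>"
proof -
  show "mono (cell_collapse \<eta> a b p)"
  proof
    fix x y :: real assume "x \<le> y"
    then have "(x - p - a) / (b - a) \<le> (y - p - a) / (b - a)"
      using assms by (intro divide_right_mono) auto
    then have "\<eta> * max 0 (min 1 ((x - p - a) / (b - a))) \<le> \<eta> * max 0 (min 1 ((y - p - a) / (b - a)))"
      using assms by (intro mult_left_mono) auto
    then show "cell_collapse \<eta> a b p x \<le> cell_collapse \<eta> a b p y"
      using \<open>x \<le> y\<close> unfolding cell_collapse_def by linarith
  qed
  show "continuous_on UNIV (cell_collapse \<eta> a b p)"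
    unfolding cell_collapse_def using assms by (intro continuous_intros) auto
  have lo: "max 0 (min 1 ((y - p - a) / (b - a))) = 0" if "y \<le> p + a"
    using that assms by (auto simp: divide_le_0_iff)
  have hi: "max 0 (min 1 ((y - p - a) / (b - a))) = 1" if "p + b \<le> y"
    using that assms by (auto simp: min_def max_def field_simps)
  show "cell_collapse \<eta> a b p y = y" if "y \<le> p \<or> p + \<eta> \<le> y"
    using that lo hi assms unfolding cell_collapse_def by auto
  show "p \<le> y \<Longrightarrow> y \<le> p + a \<Longrightarrow> cell_collapse \<eta> a b p y = p"
    using lo assms unfolding cell_collapse_def by auto
  show "p + b \<le> y \<Longrightarrow> y \<le> p + \<eta> \<Longrightarrow> cell_collapse \<eta> a b p y = p + \<eta>"
    using hi assms unfolding cell_collapse_def by auto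
  have "0 \<le> \<eta> * max 0 (min 1 ((y - p - a) / (b - a)))"
    "\<eta> * max 0 (min 1 ((y - p - a) / (b - a))) \<le> \<eta> * 1"
    using assms by (intro mult_nonneg_nonneg mult_left_mono; simp)+
  then show "p \<le> y \<Longrightarrow> y \<le> p + \<eta> \<Longrightarrow> p \<le> cell_collapse \<eta> a b p y \<and> cell_collapse \<eta> a b p y \<le> p + \<eta>"
    unfolding cell_collapse_def by auto
qed

text \<open>The collapses of \<open>N\<close> consecutive cells are composed. Points outside the
  steep middle parts are sent to end points of cells, which leaves only \<open>N + 1\<close>
  values.\<close>

lemma collapse_exists:
  assumes "0 < a" "a < b" "b < \<eta>"
  shows "\<exists>\<phi> :: real \<Rightarrow> real. mono \<phi> \<and> continuous_on UNIV \<phi> \<and>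
    (\<forall>y. y \<le> c \<or> c + real N * \<eta> \<le> y \<longrightarrow> \<phi> y = y) \<and> (\<forall>y. \<bar>\<phi> y - y\<bar> \<le> \<eta>) \<and>
    (\<forall>y. c \<le> y \<and> y \<le> c + real N * \<eta> \<and> (\<forall>j<N. y \<notin> {c + real j * \<eta> + a<..<c + real j * \<eta> + b}) \<longrightarrow>
       \<phi> y \<in> (\<lambda>j. c + real j * \<eta>) ` {..N})"
proof (induction N)
  case 0
  show ?case by (rule exI[of _ "\<lambda>y. y"]) (use assms in \<open>auto simp: mono_def\<close>)
next
  case (Suc N)
  then obtain \<phi> :: "real \<Rightarrow> real" where \<phi>: "mono \<phi>" "continuous_on UNIV \<phi>"
    "\<And>y. y \<le> c \<or> c + real N * \<eta> \<le> y \<Longrightarrow> \<phi> y = y" "\<And>y. \<bar>\<phi> y - y\<bar> \<le> \<eta>"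
    "\<And>y. c \<le> y \<Longrightarrow> y \<le> c + real N * \<eta> \<Longrightarrow> (\<forall>j<N. y \<notin> {c + real j * \<eta> + a<..<c + real j * \<eta> + b}) \<Longrightarrow>
       \<phi> y \<in> (\<lambda>j. c + real j * \<eta>) ` {..N}"
    by blast
  define p where "p = c + real N * \<eta>"
  define \<kappa> where "\<kappa> = cell_collapse \<eta> a b p"
  note \<kappa> = cell_collapse[OF assms, where p = p, folded \<kappa>_def]
  have \<eta>: "\<eta> > 0" using assms by simp
  have cp: "c \<le> p" using \<eta> by (simp add: p_def)
  have pS: "c + real (Suc N) * \<eta> = p + \<eta>" by (simp add: p_def algebra_simps)
  \<comment> \<open>On the new cell the old map is the identity and the composite is
    \<open>\<kappa>\<close>; left of \<open>p\<close> it is \<open>\<kappa>\<close> that is the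
    identity. Hence displacements do not add up.\<close>
  have id_ge: "\<phi> y = y" if "p \<le> y" for y using \<phi>(3) that by (simp add: p_def)
  show ?case
  proof (intro exI[of _ "\<phi> \<circ> \<kappa>"] conjI allI impI)
    show "mono (\<phi> \<circ> \<kappa>)" using \<phi>(1) \<kappa>(1) by (auto simp: mono_def)
    show "continuous_on UNIV (\<phi> \<circ> \<kappa>)"
      using \<phi>(2) \<kappa>(2) by (metis continuous_on_compose continuous_on_subset subset_UNIV)
    show "(\<phi> \<circ> \<kappa>) y = y" if "y \<le> c \<or> c + real (Suc N) * \<eta> \<le> y" for y
    proof -
      have "y \<le> p \<or> p + \<eta> \<le> y" using that cp unfolding pS by linarith
      then have "\<kappa> y = y" by (rule \<kappa>(3))
      moreover have "y \<le> c \<or> c + real N * \<eta> \<le> y" using that \<eta> unfolding pS p_def by linarith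
      ultimately show ?thesis using \<phi>(3) by simp
    qed
    show "\<bar>(\<phi> \<circ> \<kappa>) y - y\<bar> \<le> \<eta>" for y
    proof (cases "p \<le> y \<and> y \<le> p + \<eta>")
      case True
      then have "p \<le> \<kappa> y" "\<kappa> y \<le> p + \<eta>" using \<kappa>(4)[of y] by auto
      then show ?thesis using id_ge[of "\<kappa> y"] True by (simp add: abs_le_iff)
    next
      case False
      then have "\<kappa> y = y" by (intro \<kappa>(3)) linarith
      then show ?thesis using \<phi>(4) by simp
    qed
    show "(\<phi> \<circ> \<kappa>) y \<in> (\<lambda>j. c + real j * \<eta>) ` {..Suc N}"
      if y: "c \<le> y \<and> y \<le> c + real (Suc N) * \<eta> \<and>
        (\<forall>j<Suc N. y \<notin> {c + real j * \<eta> + a<..<c + real j * \<eta> + b})" for y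
    proof (cases "y \<le> p")
      case True
      then have "\<kappa> y = y" by (intro \<kappa>(3)) simp
      moreover have "\<phi> y \<in> (\<lambda>j. c + real j * \<eta>) ` {..N}"
        using y True by (intro \<phi>(5)) (auto simp: p_def)
      ultimately show ?thesis by auto
    next
      case False
      have "y \<notin> {p + a<..<p + b}" using y unfolding p_def by blast
      then have "\<kappa> y = p \<or> \<kappa> y = p + \<eta>"
        using \<kappa>(5)[of y] \<kappa>(6)[of y] False y pS by force
      moreover have "p \<in> (\<lambda>j. c + real j * \<eta>) ` {..Suc N}" by (auto simp: p_def)
      moreover have "p + \<eta> \<in> (\<lambda>j. c + real j * \<eta>) ` {..Suc N}" 
        unfolding pS[symmetric] by blast
      ultimately show ?thesis using id_ge \<eta> by auto
    qed
  qed
qed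

section \<open>Baire category in the space of monotone maps\<close>

text \<open>Monotone maps are represented by their bounded displacement, which makes them a closed subset of
  a Banach space; strict monotonicity is only generic.\<close>

definition mono_pert :: "(real \<Rightarrow>\<^sub>C real) set" where
  "mono_pert = {u. mono (\<lambda>y. y + apply_bcontfun u y)}"

lemma continuous_on_bcontfun_eval:
  "continuous_on UNIV (\<lambda>u :: 'a::topological_space \<Rightarrow>\<^sub>C 'b::metric_space. u y)"
  unfolding continuous_on_iff
  by (metis dist_fun_lt_imp_dist_val_lt)

lemma closed_mono_pert: "closed mono_pert"
proof -
  have "mono_pert = (\<Inter>x. \<Inter>y\<in>{x..}. {u. x + apply_bcontfun u x \<le> y + apply_bcontfun u y})"
    by (auto simp: mono_pert_def mono_def)
  moreover have "closed \<dots>"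
    by (intro closed_INT ballI closed_Collect_le continuous_intros continuous_on_bcontfun_eval)
  ultimately show ?thesis by simp
qed

text \<open>A closed subset of a complete metric space is completely metrizable, so the Baire
  category theorem applies to the traces of the sets in \<open>\<V>\<close>.\<close>

lemma generic_mono_pert:
  assumes "countable \<V>"
    and op: "\<And>V. V \<in> \<V> \<Longrightarrow> open V"
    and dense: "\<And>V u e. V \<in> \<V> \<Longrightarrow> u \<in> mono_pert \<Longrightarrow> e > 0 \<Longrightarrow> \<exists>v\<in>mono_pert \<inter> V. dist v u \<le> e"
  shows "\<exists>u\<in>mono_pert. \<forall>V\<in>\<V>. u \<in> V"
proof -
  let ?X = "top_of_set mono_pert"
  \<comment> \<open>The identity map makes the space non-empty, so that a dense intersection has a
    point.\<close>
  have 0: "(0 :: real \<Rightarrow>\<^sub>C real) \<in> mono_pert" by (simp add: mono_pert_def mono_def)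
  have "?X closure_of \<Inter>((\<inter>) mono_pert ` \<V>) = topspace ?X"
  proof (rule Baire_category)
    show "completely_metrizable_space ?X \<or> locally_compact_space ?X \<and> regular_space ?X"
      using completely_metrizable_space_closedin[OF completely_metrizable_space_euclidean] closed_mono_pert
      by (metis closed_closedin)
    show "countable ((\<inter>) mono_pert ` \<V>)" using assms(1) by blast
    fix T assume "T \<in> (\<inter>) mono_pert ` \<V>"
    then obtain V where V: "V \<in> \<V>" "T = mono_pert \<inter> V" by blast
    have "mono_pert \<subseteq> closure (mono_pert \<inter> V)"
    proof
      fix u assume u: "u \<in> mono_pert"
      show "u \<in> closure (mono_pert \<inter> V)"
        unfolding closure_approachable_le using dense[OF V(1) u] by blast
    qed
    then have "?X closure_of T = topspace ?X"
      using V by (simp add: closure_of_subtopology Int_absorb1) blast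
    then show "openin ?X T \<and> ?X closure_of T = topspace ?X"
      using V op by (simp add: openin_open_Int)
  qed
  then have "\<Inter>((\<inter>) mono_pert ` \<V>) \<inter> mono_pert \<noteq> {}"
    using 0 by (metis closure_of_empty closure_of_restrict inf_commute topspace_euclidean_subtopology emptyE)
  then show ?thesis by blast
qed

text \<open>Scaling the displacement by \<open>1 - s\<close> mixes the map with the identity, which
  increases strictly.\<close>

lemma strict_mono_pert_dense:
  assumes u: "u \<in> mono_pert" and "e > 0" "x < y"
  shows "\<exists>v\<in>mono_pert \<inter> {v. x + apply_bcontfun v x < y + apply_bcontfun v y}. dist v u \<le> e"
proof -
  \<comment> \<open>The minimum keeps \<open>1 - s\<close> nonnegative; the \<open>+ 1\<close>
    avoids division by zero when \<open>u = 0\<close>.\<close>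
  define s where "s = min 1 (e / (norm u + 1))"
  have n: "norm u + 1 > 0" by (simp add: add_nonneg_pos)
  have s: "0 < s" "s \<le> 1" "s * norm u \<le> e"
  proof -
    show "0 < s" "s \<le> 1" using \<open>e > 0\<close> n by (auto simp: s_def)
    have "s * norm u \<le> e / (norm u + 1) * norm u" by (intro mult_right_mono) (auto simp: s_def)
    also have "\<dots> \<le> e / (norm u + 1) * (norm u + 1)" using \<open>e > 0\<close> n by (intro mult_left_mono) auto
    also have "\<dots> = e" using n by simp
    finally show "s * norm u \<le> e" .
  qed
  define v where "v = (1 - s) *\<^sub>R u"
  have v: "t + v t = s * t + (1 - s) * (t + u t)" for t by (simp add: v_def algebra_simps)
  have m: "a + u a \<le> b + u b" if "a \<le> b" for a b using u that by (auto simp: mono_pert_def mono_def)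
  have "v \<in> mono_pert"
    unfolding mono_pert_def mem_Collect_eq v
  proof (rule monoI)
    fix a b :: real assume "a \<le> b"
    then show "s * a + (1 - s) * (a + u a) \<le> s * b + (1 - s) * (b + u b)"
      using s by (intro add_mono mult_left_mono m) simp_all
  qed
  moreover have "x + v x < y + v y"
    unfolding v using s m[of x y] \<open>x < y\<close> by (intro add_less_le_mono mult_strict_left_mono mult_left_mono) auto
  moreover have "dist v u \<le> e" using s by (simp add: v_def dist_norm algebra_simps)
  ultimately show ?thesis by blast
qed

text \<open>\<open>C\<close> and its compact image have a positive distance \<open>d\<close>, and a
  displacement changed by less than \<open>d\<close> cannot bridge it.\<close>

lemma disjoint_image_open:
  fixes C :: "real set"
  assumes "compact C"
  shows "open {u :: real \<Rightarrow>\<^sub>C real. \<forall>y\<in>C. y + u y \<notin> C}"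
  unfolding open_dist
proof (intro ballI)
  fix u :: "real \<Rightarrow>\<^sub>C real" assume u: "u \<in> {u. \<forall>y\<in>C. y + apply_bcontfun u y \<notin> C}"
  have "compact ((\<lambda>y. y + u y) ` C)"
    using assms by (intro compact_continuous_image continuous_intros) auto
  moreover have "(\<lambda>y. y + u y) ` C \<inter> C = {}" using u by blast
  ultimately obtain d where d: "d > 0" "\<forall>x\<in>(\<lambda>y. y + u y) ` C. \<forall>y\<in>C. d \<le> dist x y"
    using separate_compact_closed assms compact_imp_closed by metis
  show "\<exists>e>0. \<forall>v. dist v u < e \<longrightarrow> v \<in> {u. \<forall>y\<in>C. y + apply_bcontfun u y \<notin> C}"
  proof (intro exI[of _ d] conjI allI impI CollectI ballI notI)
    fix v :: "real \<Rightarrow>\<^sub>C real" and y assume "dist v u < d" "y \<in> C" "y + v y \<in> C"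
    then have "d \<le> dist (y + u y) (y + v y)" using d by blast
    also have "\<dots> = dist (v y) (u y)" by (simp add: dist_commute)
    also have "\<dots> \<le> dist v u" by (rule dist_bounded)
    finally show False using \<open>dist v u < d\<close> by simp
  qed (rule d)
qed

section \<open>Moving the traces of a meager set off themselves\<close>

text \<open>A single \<open>C\<close> controls the traces on all lines through \<open>B'\<close>,
  and the window from \<open>- real k\<close> to \<open>real k\<close> allows it to be compact; both
  make this an open condition on \<open>u\<close>.\<close>

definition separating :: "'n \<Rightarrow> (real ^ 'n::finite) set \<Rightarrow> nat \<Rightarrow> (real ^ 'n) set \<Rightarrow> (real \<Rightarrow>\<^sub>C real) set" where
  "separating i F k B = {u. \<exists>B' C. open B' \<and> B' \<noteq> {} \<and> B' \<subseteq> B \<and> compact C \<and>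
     (\<forall>x\<in>B'. \<forall>t\<in>{- real k..real k}. upd i x t \<in> F \<longrightarrow> t \<in> C) \<and> (\<forall>y\<in>C. y + apply_bcontfun u y \<notin> C)}"

lemma open_separating: "open (separating i F k B)"
proof -
  have "separating i F k B = \<Union>{{u. \<forall>y\<in>C. y + apply_bcontfun u y \<notin> C} | B' C. open B' \<and> B' \<noteq> {} \<and> B' \<subseteq> B \<and> compact C \<and>
     (\<forall>x\<in>B'. \<forall>t\<in>{- real k..real k}. upd i x t \<in> F \<longrightarrow> t \<in> C)}"
    unfolding separating_def by blast
  then show ?thesis using disjoint_image_open by auto
qed

text \<open>With \<open>f y = y + u y\<close>, the approximating map is \<open>f \<circ> \<phi> + c\<close>: here \<open>\<phi>\<close> is close to the identity and,
  away from gaps of \<open>F\<close>, takes finitely many values, whose images under \<open>f\<close> are then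
  moved by \<open>c\<close> into further gaps of \<open>F\<close>.\<close>

lemma separating_dense:
  fixes F :: "(real ^ 'n::finite) set"
  assumes u: "u \<in> mono_pert" and "e > 0" and F: "closed F" "interior F = {}"
    and B: "open B" "B \<noteq> {}"
  shows "\<exists>v\<in>mono_pert \<inter> separating i F k B. dist v u \<le> e"
proof -
  define f where "f y = y + u y" for y
  \<comment> \<open>The \<open>+ 1\<close> keeps the grid non-degenerate for
    \<open>k = 0\<close>.\<close>
  define K where "K = real k + 1"
  have K: "K > 0" by (simp add: K_def)
  have f_mono: "mono f" using u by (simp add: mono_pert_def f_def[abs_def])
  have f_cont: "continuous_on S f" for S unfolding f_def by (intro continuous_intros) auto
  have "uniformly_continuous_on {-K..K} f"
    by (intro compact_uniformly_continuous f_cont) auto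
  then obtain d where d: "d > 0" "\<And>x y. x \<in> {-K..K} \<Longrightarrow> y \<in> {-K..K} \<Longrightarrow> dist y x < d \<Longrightarrow> dist (f y) (f x) < e / 2"
    using \<open>e > 0\<close> unfolding uniformly_continuous_on_def by (metis half_gt_zero)
  obtain N :: nat where N: "real N > 2 * K / d" using reals_Archimedean2 by blast
  moreover have "2 * K / d > 0" using K d by simp
  ultimately have N0: "real N > 0" by linarith
  \<comment> \<open>\<open>N\<close> cells of this width fill \<open>{-K..K}\<close>, and a move by
    at most \<open>\<eta>\<close> inside it changes \<open>f\<close> by less than
    \<open>e / 2\<close>.\<close>
  define \<eta> where "\<eta> = 2 * K / real N"
  have \<eta>: "\<eta> > 0" "\<eta> < d" "-K + real N * \<eta> = K"
    using N N0 K d(1) by (auto simp: \<eta>_def field_simps)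
  obtain B1 a b where B1: "open B1" "B1 \<noteq> {}" "B1 \<subseteq> B" "a < b" "{a..b} \<subseteq> {0<..<\<eta>}"
    and gap: "\<forall>x\<in>B1. \<forall>\<tau>\<in>{a..b}. \<forall>s\<in>(\<lambda>j. -K + real j * \<eta>) ` {..<N}. upd i x (s + \<tau>) \<notin> F"
    using avoid_translates[of "(\<lambda>j. -K + real j * \<eta>) ` {..<N}" F B "{0<..<\<eta>}" i] F B \<eta> by auto
  have "a \<in> {0<..<\<eta>}" "b \<in> {0<..<\<eta>}"
    using B1(4) by (auto intro!: subsetD[OF B1(5)] simp del: greaterThanLessThan_iff)
  then have ab: "0 < a" "a < b" "b < \<eta>" using B1(4) by auto
  obtain \<phi> :: "real \<Rightarrow> real" where \<phi>: "mono \<phi>" "continuous_on UNIV \<phi>"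
    "\<And>y. y \<le> -K \<or> K \<le> y \<Longrightarrow> \<phi> y = y" "\<And>y. \<bar>\<phi> y - y\<bar> \<le> \<eta>"
    "\<And>y. -K \<le> y \<Longrightarrow> y \<le> K \<Longrightarrow> (\<forall>j<N. y \<notin> {-K + real j * \<eta> + a<..<-K + real j * \<eta> + b}) \<Longrightarrow>
       \<phi> y \<in> (\<lambda>j. -K + real j * \<eta>) ` {..N}"
    using collapse_exists[OF ab, of "-K" N] unfolding \<eta>(3) by blast
  \<comment> \<open>\<open>S\<close> contains all values of \<open>f \<circ> \<phi>\<close> at
    points of \<open>{-K..K}\<close> outside the first gaps. Its finiteness permits a second choice
    of gaps.\<close>
  define S where "S = f ` (\<lambda>j. -K + real j * \<eta>) ` {..N}"
  have "finite S" by (simp add: S_def)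
  then obtain B2 a' b' where B2: "open B2" "B2 \<noteq> {}" "B2 \<subseteq> B1" "a' < b'" "{a'..b'} \<subseteq> {0<..<e/2}"
    and gap': "\<forall>x\<in>B2. \<forall>\<tau>\<in>{a'..b'}. \<forall>s\<in>S. upd i x (s + \<tau>) \<notin> F"
    using avoid_translates[of S F B1 "{0<..<e/2}" i] F B1 \<open>e > 0\<close> by auto
  define c where "c = (a' + b') / 2"
  have c: "a' < c" "c < b'" using B2(4) by (auto simp: c_def)
  then have c': "0 < c" "c < e / 2" using B2(5) by (auto simp: subset_iff)
  \<comment> \<open>Both families of gaps miss \<open>F\<close> over \<open>B2\<close>, so the
    traces of \<open>F\<close> survive in \<open>C\<close>. For \<open>y\<close> in
    \<open>C\<close>, however, \<open>f (\<phi> y) + c\<close> falls into a removed gap of the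
    second family.\<close>
  define C where "C = {-real k..real k} - (\<Union>j<N. {-K + real j * \<eta> + a<..<-K + real j * \<eta> + b})
    - (\<Union>s\<in>S. {s + a'<..<s + b'})"
  have "compact C" unfolding C_def
    by (intro compact_diff compact_Icc open_UN ballI open_greaterThanLessThan)
  define w where "w y = f (\<phi> y) + c - y" for y
  \<comment> \<open>One half of \<open>e\<close> pays for \<open>\<phi>\<close>, the other for the
    shift \<open>c\<close>.\<close>
  have close: "\<bar>w y - u y\<bar> \<le> e" for y
  proof -
    have "\<bar>f (\<phi> y) - f y\<bar> \<le> e / 2"
    proof (cases "y \<in> {-K..K}")
      case True
      \<comment> \<open>\<open>\<phi>\<close> fixes both end points, so by monotonicity it stays
        where uniform continuity is available.\<close>
      have "\<phi> (-K) \<le> \<phi> y" "\<phi> y \<le> \<phi> K" using True \<phi>(1) by (auto simp: mono_def)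
      then have "\<phi> y \<in> {-K..K}" using \<phi>(3)[of K] \<phi>(3)[of "-K"] by simp
      moreover have "dist (\<phi> y) y < d" using \<phi>(4)[of y] \<eta>(2) by (simp add: dist_real_def)
      ultimately show ?thesis using d(2)[of y "\<phi> y"] True by (simp add: dist_real_def)
    next
      case False
      then show ?thesis using \<phi>(3)[of y] \<open>e > 0\<close> by auto
    qed
    moreover have "w y - u y = f (\<phi> y) - f y + c" by (simp add: w_def f_def)
    ultimately show ?thesis using c' by linarith
  qed
  have "w \<in> bcontfun"
  proof (rule bcontfun_normI)
    show "continuous_on UNIV w" unfolding w_def
      by (intro continuous_intros continuous_on_compose2[OF f_cont[of UNIV] \<phi>(2)]) auto
    show "norm (w y) \<le> norm u + e" for y
      using close[of y] norm_bounded[of u y] by simp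
  qed
  then obtain v where v: "w = apply_bcontfun v" by (rule bcontfunE)
  have fv: "y + v y = f (\<phi> y) + c" for y using v[symmetric] by (simp add: w_def)
  have "v \<in> mono_pert"
    unfolding mono_pert_def mem_Collect_eq fv using f_mono \<phi>(1) by (auto simp: mono_def)
  moreover have "dist v u \<le> e"
    by (rule dist_bound) (use close v in \<open>auto simp: dist_real_def\<close>)
  moreover have "v \<in> separating i F k B"
    unfolding separating_def
  proof (intro CollectI exI[of _ B2] exI[of _ C] conjI ballI impI \<open>compact C\<close> B2(1,2))
    show "B2 \<subseteq> B" using B2(3) B1(3) by blast
    show "t \<in> C" if "x \<in> B2" "t \<in> {-real k..real k}" "upd i x t \<in> F" for x t
    proof -
      have "x \<in> B1" using that B2(3) by blast
      have "t \<notin> {-K + real j * \<eta> + a<..<-K + real j * \<eta> + b}" if "j < N" for j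
      proof
        assume t: "t \<in> {-K + real j * \<eta> + a<..<-K + real j * \<eta> + b}"
        have "upd i x ((-K + real j * \<eta>) + (t - (-K + real j * \<eta>))) \<notin> F"
          using gap[rule_format, OF \<open>x \<in> B1\<close>, of "t - (-K + real j * \<eta>)" "-K + real j * \<eta>"] t \<open>j < N\<close> by auto
        then show False using \<open>upd i x t \<in> F\<close> by simp
      qed
      moreover have "t \<notin> {s + a'<..<s + b'}" if "s \<in> S" for s
      proof
        assume t: "t \<in> {s + a'<..<s + b'}"
        have "upd i x (s + (t - s)) \<notin> F"
          using gap'[rule_format, OF \<open>x \<in> B2\<close>, of "t - s" s] t \<open>s \<in> S\<close> by auto
        then show False using \<open>upd i x t \<in> F\<close> by simp
      qed
      ultimately show ?thesis using that(2) unfolding C_def by blast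
    qed
    show "y + v y \<notin> C" if "y \<in> C" for y
    proof -
      have "\<phi> y \<in> (\<lambda>j. -K + real j * \<eta>) ` {..N}"
        using that by (intro \<phi>(5)) (auto simp: C_def K_def)
      then have "f (\<phi> y) \<in> S" unfolding S_def by blast
      moreover have "f (\<phi> y) + c \<in> {f (\<phi> y) + a'<..<f (\<phi> y) + b'}" using c by simp
      ultimately show ?thesis unfolding fv C_def by blast
    qed
  qed
  ultimately show ?thesis by blast
qed

lemma bounded_displacement_surj:
  fixes g :: "real \<Rightarrow> real"
  assumes "continuous_on UNIV g" "\<And>y. \<bar>g y - y\<bar> \<le> M"
  shows "surj g"
proof -
  have "\<exists>y. g y = z" for z
  proof -
    have "g (z - M) \<le> z" "z \<le> g (z + M)" "z - M \<le> z + M"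
      using assms(2)[of "z - M"] assms(2)[of "z + M"] assms(2)[of 0] by linarith+
    then show ?thesis using IVT'[of g "z - M" z "z + M"] assms(1) continuous_on_subset by blast
  qed
  then show ?thesis by (metis surjI surj_def)
qed

text \<open>A countable base and rational pairs reduce all requirements on \<open>g\<close> to
  countably many open dense ones. A generic displacement meets them, and the exceptional lines are
  then excluded by dense open sets, one for each window.\<close>

lemma fibrewise_disjoint_meager:
  fixes A :: "(real ^ 'n::finite) set"
  assumes "meager A"
  obtains g :: "real \<Rightarrow> real" where "strict_mono g" "continuous_on UNIV g" "surj g"
    "meager {x. \<exists>t. upd i x t \<in> A \<and> upd i x (g t) \<in> A}"
proof -
  obtain F :: "nat \<Rightarrow> (real ^ 'n) set" where F0: "\<forall>k. closed (F k) \<and> interior (F k) = {}" "mono F" "A \<subseteq> (\<Union>k. F k)"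
    using assms by (rule meager_increasing_closed_cover)
  have F: "closed (F k)" "interior (F k) = {}" "mono F" "A \<subseteq> (\<Union>k. F k)" for k
    using F0 by auto
  obtain \<B> :: "(real ^ 'n) set set" where \<B>: "countable \<B>" "\<And>C. C \<in> \<B> \<Longrightarrow> open C"
      "\<And>S. open S \<Longrightarrow> \<exists>U\<subseteq>\<B>. S = \<Union>U"
    using univ_second_countable by blast
  define \<V> where "\<V> = (\<lambda>(k, B). separating i (F k) k B) ` (UNIV \<times> (\<B> - {{}})) \<union>
     (\<lambda>(x, y). {v. x + apply_bcontfun v x < y + apply_bcontfun v y}) ` {(x, y). x \<in> \<rat> \<and> y \<in> \<rat> \<and> x < y}"
  have "\<exists>u\<in>mono_pert. \<forall>V\<in>\<V>. u \<in> V"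
  proof (rule generic_mono_pert)
    have "countable {(x, y). x \<in> \<rat> \<and> y \<in> \<rat> \<and> x < (y::real)}"
      by (rule countable_subset[of _ "\<rat> \<times> \<rat>"]) (auto intro!: countable_SIGMA countable_rat)
    then show "countable \<V>" unfolding \<V>_def using \<B>(1) by (intro countable_Un countable_image) auto
    have "open {v. x + apply_bcontfun v x < y + apply_bcontfun v y}" for x y :: real
      by (intro open_Collect_less continuous_intros continuous_on_bcontfun_eval)
    then show "open V" if "V \<in> \<V>" for V using that by (auto simp: \<V>_def open_separating)
    show "\<exists>v\<in>mono_pert \<inter> V. dist v u \<le> e" if "V \<in> \<V>" "u \<in> mono_pert" "e > 0" for V u e
      using that separating_dense[OF that(2,3) F(1,2) \<B>(2)] strict_mono_pert_dense[OF that(2,3)]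
      unfolding \<V>_def by auto
  qed
  then obtain u where u: "u \<in> mono_pert" "\<And>V. V \<in> \<V> \<Longrightarrow> u \<in> V" by blast
  define g where "g y = y + u y" for y
  have g_cont: "continuous_on UNIV g" unfolding g_def by (intro continuous_intros) auto
  have g_mono: "mono g" using u by (simp add: mono_pert_def g_def[abs_def])
  have "strict_mono g"
  proof
    fix x y :: real assume "x < y"
    \<comment> \<open>Strictness was imposed at rational pairs only; monotonicity carries it from
      \<open>q < r\<close> to \<open>x < y\<close>.\<close>
    obtain q where q: "q \<in> \<rat>" "x < q" "q < y" using Rats_dense_in_real[OF \<open>x < y\<close>] by blast
    obtain r where r: "r \<in> \<rat>" "q < r" "r < y" using Rats_dense_in_real[OF q(3)] by blast
    have "{v. q + apply_bcontfun v q < r + apply_bcontfun v r} \<in> \<V>" using q r unfolding \<V>_def by auto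
    then have "g q < g r" using u(2) by (auto simp: g_def)
    moreover have "g x \<le> g q" "g r \<le> g y" using g_mono q r by (auto simp: mono_def)
    ultimately show "g x < g y" by linarith
  qed
  moreover have "surj g"
  proof (rule bounded_displacement_surj[OF g_cont])
    show "\<bar>g y - y\<bar> \<le> norm u" for y using norm_bounded[of u y] by (simp add: g_def)
  qed
  moreover have "meager {x. \<exists>t. upd i x t \<in> A \<and> upd i x (g t) \<in> A}"
  proof -
    define U where "U k = \<Union>{B'. open B' \<and> (\<forall>x\<in>B'. \<forall>t\<in>{-real k..real k}. g t \<in> {-real k..real k} \<longrightarrow>
        \<not> (upd i x t \<in> F k \<and> upd i x (g t) \<in> F k))}" for k
    have "open (U k)" for k unfolding U_def by auto
    moreover have "closure (U k) = UNIV" for k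
    proof -
      have *: "U k \<inter> O' \<noteq> {}" if O': "open O'" "O' \<noteq> {}" for O'
      proof -
        obtain B where B: "B \<in> \<B>" "B \<noteq> {}" "B \<subseteq> O'" using \<B>(3)[OF O'(1)] O'(2) by (metis Sup_le_iff Union_empty_conv subset_iff)
        then have "separating i (F k) k B \<in> \<V>" unfolding \<V>_def by auto
        then have "u \<in> separating i (F k) k B" by (rule u(2))
        then obtain B' C where B': "open B'" "B' \<noteq> {}" "B' \<subseteq> B"
          and C: "\<forall>x\<in>B'. \<forall>t\<in>{- real k..real k}. upd i x t \<in> F k \<longrightarrow> t \<in> C" "\<forall>y\<in>C. g y \<notin> C"
          unfolding separating_def g_def by blast
        \<comment> \<open>A collision inside the window would put both \<open>t\<close> and
          \<open>g t\<close> into \<open>C\<close>.\<close>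
        have "B' \<subseteq> U k" unfolding U_def
          by (rule Union_upper) (use B'(1) C in blast)
        moreover have "B' \<subseteq> O'" using B' B by (meson order_trans)
        ultimately show ?thesis using B'(2) by blast
      qed
      have "- closure (U k) = {}"
      proof (rule ccontr)
        assume "- closure (U k) \<noteq> {}"
        then have "U k \<inter> - closure (U k) \<noteq> {}" by (intro *) (simp_all add: open_Compl)
        then show False using closure_subset by blast
      qed
      then show ?thesis by blast
    qed
    ultimately have "meager (- (\<Inter>k. U k))" by (rule meager_Compl_Inter_open_dense)
    moreover have "{x. \<exists>t. upd i x t \<in> A \<and> upd i x (g t) \<in> A} \<subseteq> - (\<Inter>k. U k)"
    proof (clarify)
      fix x t assume x: "upd i x t \<in> A" "upd i x (g t) \<in> A" "x \<in> (\<Inter>k. U k)"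
      obtain k1 k2 where k: "upd i x t \<in> F k1" "upd i x (g t) \<in> F k2" using x F(4) by blast
      obtain k3 :: nat where k3: "max \<bar>t\<bar> \<bar>g t\<bar> \<le> real k3" using real_arch_simple by blast
      \<comment> \<open>One index serves both points and the window, since \<open>F\<close> is
        increasing.\<close>
      define k where "k = Max {k1, k2, k3}"
      have "k1 \<le> k" "k2 \<le> k" "k3 \<le> k" by (auto simp: k_def)
      then have "F k1 \<subseteq> F k" "F k2 \<subseteq> F k" "real k3 \<le> real k" using F(3) by (auto simp: mono_def)
      then have "upd i x t \<in> F k" "upd i x (g t) \<in> F k" "t \<in> {-real k..real k}" "g t \<in> {-real k..real k}"
        using k k3 by (auto simp: max_def split: if_splits)
      moreover have "x \<in> U k" using x by blast
      ultimately show False unfolding U_def by blast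
    qed
    ultimately show ?thesis by (rule meager_subset)
  qed
  ultimately show ?thesis using that g_cont by blast
qed

section \<open>Enlarging a member of the ideal to the whole space\<close>

text \<open>Invariance of domain supplies a continuous inverse from injectivity alone.\<close>

lemma homeomorphism_coordinate:
  fixes g :: "real \<Rightarrow> real" and i :: "'n::finite"
  assumes "strict_mono g" "continuous_on UNIV g" "surj g"
  obtains h' where "homeomorphism UNIV UNIV (\<lambda>x. upd i x (g (x $ i))) h'"
proof -
  let ?h = "\<lambda>x. upd i x (g (x $ i))"
  have "continuous_on UNIV ?h"
    by (intro continuous_intros continuous_on_compose2[OF assms(2)]) auto
  moreover have "inj ?h"
  proof (rule injI)
    fix x y :: "real ^ 'n" assume eq: "?h x = ?h y"
    have "?h x $ j = ?h y $ j" for j using eq by simp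
    then have "g (x $ i) = g (y $ i)" "j \<noteq> i \<Longrightarrow> x $ j = y $ j" for j
      by (metis upd_nth)+
    then show "x = y" using assms(1) by (metis strict_mono_eq vec_eq_iff)
  qed
  ultimately obtain h' where "homeomorphism UNIV (range ?h) ?h h'"
    using invariance_of_domain_homeomorphism[of UNIV ?h] by auto
  moreover have "range ?h = UNIV"
  proof -
    have "y \<in> range ?h" for y
    proof -
      obtain t where "g t = y $ i" using assms(3) by (metis surjD)
      then have "y = ?h (upd i y t)" by (simp add: vec_eq_iff)
      then show ?thesis by (rule range_eqI)
    qed
    then show ?thesis by blast
  qed
  ultimately show ?thesis using that by simp
qed

lemma topologically_invariant_image:
  assumes "topologically_invariant \<I>" "homeomorphism UNIV UNIV h g" "A \<in> \<I>"
  shows "h ` A \<in> \<I>"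
  using assms unfolding topologically_invariant_def by blast

lemma sigma_ideal_subset: "set_sigma_ideal \<I> \<Longrightarrow> A \<in> \<I> \<Longrightarrow> B \<subseteq> A \<Longrightarrow> B \<in> \<I>"
  unfolding set_sigma_ideal_def set_ideal_def by blast

lemma sigma_ideal_Un: "set_sigma_ideal \<I> \<Longrightarrow> A \<in> \<I> \<Longrightarrow> B \<in> \<I> \<Longrightarrow> A \<union> B \<in> \<I>"
  unfolding set_sigma_ideal_def set_ideal_def by blast

lemma sigma_ideal_Union: "set_sigma_ideal \<I> \<Longrightarrow> countable \<C> \<Longrightarrow> \<C> \<subseteq> \<I> \<Longrightarrow> \<Union>\<C> \<in> \<I>"
  unfolding set_sigma_ideal_def by blast

text \<open>Modulo a meager set \<open>B\<close> is a non-empty open \<open>U\<close>, and the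
  translates of \<open>U\<close> by a countable dense set cover the space.\<close>

lemma comeager_in_ideal:
  fixes \<I> :: "'a::euclidean_space set set"
  assumes I: "set_sigma_ideal \<I>" "topologically_invariant \<I>"
    and B: "B \<in> \<I>" "has_Baire_property B" "\<not> meager B"
  obtains A where "A \<in> \<I>" "meager (- A)"
proof -
  obtain U where U: "open U" "meager (sym_diff B U)"
    using B(2) unfolding has_Baire_property_def by blast
  have "U \<noteq> {}" using U(2) B(3) by auto
  then obtain z where z: "z \<in> U" by blast
  obtain D :: "'a set" where D: "countable D" "\<And>X. open X \<Longrightarrow> X \<noteq> {} \<Longrightarrow> \<exists>d\<in>D. d \<in> X"
    using countable_dense_exists by blast
  define A where "A = (\<Union>q\<in>D. (+) q ` B)"
  have "(+) q ` B \<in> \<I>" for q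
  proof (rule topologically_invariant_image[OF I(2) _ B(1)])
    show "homeomorphism UNIV UNIV ((+) q) ((+) (-q))"
      unfolding homeomorphism_def by (auto intro!: continuous_intros simp: surj_plus)
  qed
  then have "A \<in> \<I>" unfolding A_def using D(1) I(1) by (intro sigma_ideal_Union) auto
  have "- A \<subseteq> (\<Union>q\<in>D. (+) q ` sym_diff B U)"
  proof
    fix x assume x: "x \<in> - A"
    \<comment> \<open>The shifts \<open>q\<close> with \<open>x - q\<close> in \<open>U\<close> form
      a non-empty open set, so \<open>D\<close> contains one.\<close>
    have "open ((\<lambda>q. x - q) -` U)" by (intro open_vimage U continuous_intros)
    moreover have "x - z \<in> (\<lambda>q. x - q) -` U" using z by simp
    ultimately obtain q where q: "q \<in> D" "x - q \<in> U" using D(2) by blast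
    have "x - q \<notin> B"
    proof
      assume "x - q \<in> B"
      then have "q + (x - q) \<in> (+) q ` B" by (rule imageI)
      then show False using x q(1) by (simp add: A_def)
    qed
    then have "q + (x - q) \<in> (+) q ` sym_diff B U" using q by (intro imageI) blast
    then show "x \<in> (\<Union>q\<in>D. (+) q ` sym_diff B U)" using q by auto
  qed
  moreover have "meager (\<Union>q\<in>D. (+) q ` sym_diff B U)"
    using D(1) meager_translation[OF U(2)] by (intro meager_Union) auto
  ultimately have "meager (- A)" using meager_subset by blast
  with \<open>A \<in> \<I>\<close> show ?thesis by (rule that)
qed

lemma comeager_cylinder_in_ideal:
  fixes \<I> :: "(real ^ 'n::finite) set set"
  assumes I: "set_sigma_ideal \<I>" "topologically_invariant \<I>"
    and A0: "A0 \<in> \<I>" "meager (- A0)"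
    and "finite S"
  shows "\<exists>A\<in>\<I>. meager (- A) \<and> (\<forall>j\<in>S. \<forall>x\<in>A. \<forall>t. upd j x t \<in> A)"
  using \<open>finite S\<close>
proof (induction S rule: finite_induct)
  case empty
  then show ?case using A0 by auto
next
  case (insert i S)
  then obtain A where A: "A \<in> \<I>" "meager (- A)" "\<And>j x t. j \<in> S \<Longrightarrow> x \<in> A \<Longrightarrow> upd j x t \<in> A"
    by blast
  obtain g where g: "strict_mono g" "continuous_on UNIV g" "surj g"
    and m: "meager {x. \<exists>t. upd i x t \<in> - A \<and> upd i x (g t) \<in> - A}"
    using fibrewise_disjoint_meager[OF A(2)] by blast
  define h where "h x = upd i x (g (x $ i))" for x
  obtain h' where h': "homeomorphism UNIV UNIV h h'"
    using homeomorphism_coordinate[OF g, of i] unfolding h_def by blast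
  define E where "E = A \<union> h ` A"
  have E: "E \<in> \<I>" unfolding E_def using I A(1) topologically_invariant_image[OF I(2) h'] by (intro sigma_ideal_Un) auto
  have inj_h: "inj h" using h' by (metis homeomorphism_apply1 injI UNIV_I)
  \<comment> \<open>\<open>h\<close> reads and changes only coordinate \<open>i\<close>, so it
    commutes with changes of the coordinates in \<open>S\<close>.\<close>
  have E_cyl: "upd j x t \<in> E" if "j \<in> S" "x \<in> E" for j x t
  proof -
    have "j \<noteq> i" using that insert by blast
    then have "upd j (h a) t = h (upd j a t)" for a by (simp add: h_def upd_commute)
    then show ?thesis using that A(3) unfolding E_def by auto
  qed
  \<comment> \<open>\<open>A'\<close> is the union of the lines in direction \<open>i\<close> that
    lie entirely in \<open>E\<close>.\<close>
  define A' where "A' = {x. \<forall>t. upd i x t \<in> E}"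
  have "A' \<subseteq> E" unfolding A'_def by (metis (mono_tags) mem_Collect_eq subsetI upd_same)
  then have "A' \<in> \<I>" using sigma_ideal_subset[OF I(1) E] by blast
  moreover have "meager (- A')"
  proof (rule meager_subset[OF m], rule subsetI)
    fix x assume "x \<in> - A'"
    then obtain s where s: "upd i x s \<notin> E" by (auto simp: A'_def)
    obtain t where t: "s = g t" using g(3) by (metis surjD)
    have "h (upd i x t) = upd i x s" by (simp add: h_def t)
    then have "upd i x t \<notin> A" using s unfolding E_def by (metis UnCI imageI)
    then show "x \<in> {x. \<exists>t. upd i x t \<in> - A \<and> upd i x (g t) \<in> - A}" using s t by (auto simp: E_def)
  qed
  moreover have "upd j x t \<in> A'" if "j \<in> insert i S" "x \<in> A'" for j x t
  proof (cases "j = i")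
    case True
    then show ?thesis using that by (simp add: A'_def)
  next
    case False
    then show ?thesis using that E_cyl by (simp add: A'_def upd_commute[of i j])
  qed
  ultimately show ?case by blast
qed

text \<open>Starting from \<open>a\<close>, the coordinates of an arbitrary \<open>y\<close> are put
  in one at a time.\<close>

lemma all_coordinates_cylinder:
  fixes A :: "(real ^ 'n::finite) set"
  assumes "a \<in> A" and cyl: "\<And>j x t. x \<in> A \<Longrightarrow> upd j x t \<in> A"
  shows "A = UNIV"
proof -
  have "(\<chi> j. if j \<in> T then y $ j else a $ j) \<in> A" if "finite T" for T y
    using that
  proof (induction T rule: finite_induct)
    case (insert i T)
    have "(\<chi> j. if j \<in> insert i T then y $ j else a $ j) =
        upd i (\<chi> j. if j \<in> T then y $ j else a $ j) (y $ i)"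
      by (auto simp: vec_eq_iff)
    then show ?case using cyl insert by metis
  qed (use assms in simp)
  from this[of UNIV] show ?thesis by auto
qed

theorem theorem2p1:
  fixes \<I> :: "(real ^ 'n::finite) set set"
  assumes "set_sigma_ideal \<I>"
    and "nontrivial_ideal \<I>"
    and "topologically_invariant \<I>"
    and "has_BP_base \<I>"
  shows "\<I> \<subseteq> {A. meager A}"
proof (rule ccontr)
  assume "\<not> \<I> \<subseteq> {A. meager A}"
  then obtain A0 where A0: "A0 \<in> \<I>" "\<not> meager A0" by blast
  obtain \<B> where \<B>: "ideal_base \<I> \<B>" "\<forall>B\<in>\<B>. has_Baire_property B"
    using assms(4) unfolding has_BP_base_def by blast
  obtain B where B: "B \<in> \<B>" "A0 \<subseteq> B" "B \<in> \<I>"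
    using \<B>(1) A0 unfolding ideal_base_def by blast
  then have "\<not> meager B" using A0(2) meager_subset by blast
  then obtain A1 where "A1 \<in> \<I>" "meager (- A1)"
    using comeager_in_ideal[OF assms(1,3)] B \<B>(2) by metis
  then obtain A where A: "A \<in> \<I>" "meager (- A)" "\<And>j x t. x \<in> A \<Longrightarrow> upd j x t \<in> A"
    using comeager_cylinder_in_ideal[OF assms(1,3), of A1 UNIV] by auto
  have "A \<noteq> {}" using A(2) not_meager_UNIV by auto
  then have "A = UNIV" using all_coordinates_cylinder[of _ A] A(3) by blast
  then have "\<I> = Pow UNIV" using A(1) sigma_ideal_subset[OF assms(1)] by blast
  then show False using assms(2) unfolding nontrivial_ideal_def by blast
qed

end
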